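(* Let $m\ge 2$ be an integer and let $H$ be a connected graph of order at least $2$ without a universal vertex. (i) If $\operatorname{diam}(H)=2$, then $\mathrm{gp}_{\rm o}(K_m\circ H)=\mathrm{gp}_{\rm o}(H)$. (ii) If $\operatorname{diam}(H)>2$, then $\mathrm{gp}_{\rm o}(K_m\circ H)=\mathrm{gp}_{\rm o}(K_1+H)$.
   Context: All graphs are finite and simple, and (as a standing assumption of the paper) connected. For $X\subseteq V(G)$, two vertices $u,v$ are $X$-positionable if no shortest $u,v$-path has an internal vertex in $X$. $X$ is an outer general position set if every two vertices of $X$ are $X$-positionable and every $u\in X$, $v\in V(G)\setminus X$ are $X$-positionable; $\mathrm{gp}_{\rm o}$ is the maximum cardinality of such a set. A universal vertex is adjacent to all other vertices. $K_1+H$ is the join of $K_1$ with $H$. The lexicographic product $G\circ H$ has vertex set $V(G)\times V(H)$, with $(g,h)$ and $(g',h')$ adjacent iff either $gg'\in E(G)$, or $g=g'$ and $hh'\in E(H)$. *)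

theory Defs
  imports "Graph_Theory.Graph_Theory"
begin

text \<open>
  Finite simple graphs are the symmetric loop-free digraphs of \<^locale>\<open>pair_graph\<close>. Paths are
  arc lists; \<open>u\<close> and \<open>v\<close> are the ends of the path in \<open>apath u p v\<close>.
\<close>

definition graph_dist :: "'a pair_pre_digraph \<Rightarrow> 'a \<Rightarrow> 'a \<Rightarrow> ereal" where
  "graph_dist G u v = wf_digraph.\<mu> (with_proj G) (\<lambda>_. 1) u v"

definition graph_diam :: "'a pair_pre_digraph \<Rightarrow> ereal" where
  "graph_diam G = (SUP u\<in>pverts G. SUP v\<in>pverts G. graph_dist G u v)"

definition shortest_path :: "'a pair_pre_digraph \<Rightarrow> 'a \<Rightarrow> ('a \<times> 'a) awalk \<Rightarrow> 'a \<Rightarrow> bool" where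
  "shortest_path G u p v \<longleftrightarrow>
     pre_digraph.apath (with_proj G) u p v \<and> ereal (real (length p)) = graph_dist G u v"

definition positionable :: "'a pair_pre_digraph \<Rightarrow> 'a set \<Rightarrow> 'a \<Rightarrow> 'a \<Rightarrow> bool" where
  "positionable G X u v \<longleftrightarrow>
     (\<forall>p. shortest_path G u p v \<longrightarrow> (set (pawalk_verts u p) - {u, v}) \<inter> X = {})"

definition outer_general_position :: "'a pair_pre_digraph \<Rightarrow> 'a set \<Rightarrow> bool" where
  "outer_general_position G X \<longleftrightarrow>
     X \<subseteq> pverts G \<and>
     (\<forall>u\<in>X. \<forall>v\<in>X. positionable G X u v) \<and>
     (\<forall>u\<in>X. \<forall>v\<in>pverts G - X. positionable G X u v)"

definition gp_o :: "'a pair_pre_digraph \<Rightarrow> nat" where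
  "gp_o G = Max (card ` {X. outer_general_position G X})"

definition universal_vertex :: "'a pair_pre_digraph \<Rightarrow> 'a \<Rightarrow> bool" where
  "universal_vertex G u \<longleftrightarrow> u \<in> pverts G \<and> (\<forall>v\<in>pverts G - {u}. (u, v) \<in> parcs G)"

definition graph_join ::
    "'a pair_pre_digraph \<Rightarrow> 'b pair_pre_digraph \<Rightarrow> ('a + 'b) pair_pre_digraph" where
  "graph_join G H = \<lparr>
     pverts = pverts G <+> pverts H,
     parcs = {(Inl g, Inl g') | g g'. (g, g') \<in> parcs G}
           \<union> {(Inr h, Inr h') | h h'. (h, h') \<in> parcs H}
           \<union> {(Inl g, Inr h) | g h. g \<in> pverts G \<and> h \<in> pverts H}
           \<union> {(Inr h, Inl g) | g h. g \<in> pverts G \<and> h \<in> pverts H} \<rparr>"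

definition lex_product ::
    "'a pair_pre_digraph \<Rightarrow> 'b pair_pre_digraph \<Rightarrow> ('a \<times> 'b) pair_pre_digraph" where
  "lex_product G H = \<lparr>
     pverts = pverts G \<times> pverts H,
     parcs = {((g, h), (g', h')) | g h g' h'.
                g \<in> pverts G \<and> g' \<in> pverts G \<and> h \<in> pverts H \<and> h' \<in> pverts H \<and>
                ((g, g') \<in> parcs G \<or> g = g' \<and> (h, h') \<in> parcs H)} \<rparr>"

lemma pair_graph_graph_join:
  assumes "pair_graph G" "pair_graph H"
  shows "pair_graph (graph_join G H)"
proof -
  interpret G: pair_graph G by fact
  interpret H: pair_graph H by fact
  have fin: "finite (pverts (graph_join G H))"
    by (simp add: graph_join_def G.pair_finite_verts H.pair_finite_verts)
  have sub: "parcs (graph_join G H) \<subseteq> pverts (graph_join G H) \<times> pverts (graph_join G H)"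
    by (auto simp: graph_join_def dest: G.wellformed' H.wellformed')
  then have finE: "finite (parcs (graph_join G H))"
    using fin by (meson finite_SigmaI finite_subset)
  have sym: "symmetric (with_proj (graph_join G H))"
    by (auto simp: symmetric_def graph_join_def intro!: symI
        dest: G.arcs_symmetric H.arcs_symmetric)
  have loop: "fst e \<noteq> snd e" if "e \<in> parcs (graph_join G H)" for e
    using that by (auto simp: graph_join_def dest: G.no_loops' H.no_loops')
  show ?thesis
    using fin finE sub sym loop by unfold_locales auto
qed

lemma pair_graph_lex_product:
  assumes "pair_graph G" "pair_graph H"
  shows "pair_graph (lex_product G H)"
proof -
  interpret G: pair_graph G by fact
  interpret H: pair_graph H by fact
  have fin: "finite (pverts (lex_product G H))"
    by (simp add: lex_product_def G.pair_finite_verts H.pair_finite_verts)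
  have sub: "parcs (lex_product G H) \<subseteq> pverts (lex_product G H) \<times> pverts (lex_product G H)"
    by (auto simp: lex_product_def)
  then have finE: "finite (parcs (lex_product G H))"
    using fin by (meson finite_SigmaI finite_subset)
  have sym: "symmetric (with_proj (lex_product G H))"
    by (auto simp: symmetric_def lex_product_def intro!: symI
        dest: G.arcs_symmetric H.arcs_symmetric)
  have loop: "fst e \<noteq> snd e" if "e \<in> parcs (lex_product G H)" for e
    using that by (auto simp: lex_product_def dest: G.no_loops' H.no_loops')
  show ?thesis
    using fin finE sub sym loop by unfold_locales auto
qed

lemma outer_general_position_empty: "outer_general_position G {}"
  by (simp add: outer_general_position_def)

lemma finite_outer_general_position:
  assumes "pair_graph G"
  shows "finite {X. outer_general_position G X}"
proof -
  interpret pair_graph G by fact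
  have "{X. outer_general_position G X} \<subseteq> Pow (pverts G)"
    by (auto simp: outer_general_position_def)
  then show ?thesis
    using pair_finite_verts by (meson finite_Pow_iff finite_subset)
qed

end

theory Submission
  imports Defs
begin

text \<open>
  In a graph of diameter at most two, a shortest path with an inner vertex is an induced path
  \<open>x y v\<close>. Hence a set is an outer general position set iff any two adjacent members have the same
  closed neighbourhood. Both \<open>K\<^sub>m \<circ> H\<close> and \<open>K\<^sub>1 + H\<close> have diameter at most two. As \<open>H\<close> has no
  universal vertex, adjacent vertices of \<open>K\<^sub>m \<circ> H\<close> in different layers are not true twins, and
  neither is the apex of \<open>K\<^sub>1 + H\<close> a true twin of a vertex of \<open>H\<close>. So in both graphs these sets are,
  up to singletons, the copies of the sets of this kind in \<open>H\<close>.
\<close>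

text \<open>One inclusion of closed neighbourhoods suffices: in a \<open>pair_graph\<close> arcs are
  symmetric, so exchanging \<open>x\<close> and \<open>y\<close> gives the other. The vertex
  \<open>v\<close> ranges over the whole graph because the outer condition also concerns vertices
  outside \<open>X\<close>; \<open>v \<noteq> x\<close> accounts for the missing loop at
  \<open>x\<close>.\<close>

definition adjacent_twins :: "'a pair_pre_digraph \<Rightarrow> 'a set \<Rightarrow> bool" where
  "adjacent_twins G X \<longleftrightarrow> X \<subseteq> pverts G \<and>
     (\<forall>x\<in>X. \<forall>y\<in>X. \<forall>v. (x, y) \<in> parcs G \<and> (y, v) \<in> parcs G \<and> v \<noteq> x \<longrightarrow> (x, v) \<in> parcs G)"

definition diam_le_2 :: "'a pair_pre_digraph \<Rightarrow> bool" where
  "diam_le_2 G \<longleftrightarrow> (\<forall>u\<in>pverts G. \<forall>v\<in>pverts G. graph_dist G u v \<le> 2)"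

lemma diam_le_2I_graph_diam: "graph_diam G \<le> 2 \<Longrightarrow> diam_le_2 G"
  unfolding diam_le_2_def graph_diam_def by (simp add: SUP_le_iff)

section \<open>Distances and outer general position in diameter at most two\<close>

context pair_graph
begin

text \<open>With unit costs \<open>\<mu>\<close> is the infimum of all walk lengths, so each walk
  bounds it from above.\<close>

lemma graph_dist_le_length:
  assumes "awalk u p v"
  shows "graph_dist G u v \<le> ereal (real (length p))"
  using min_cost_le_walk_cost[OF assms, of "\<lambda>_. 1"]
  by (simp add: graph_dist_def awalk_cost_def sum_list_triv)

lemma graph_dist_geI:
  assumes "\<And>p. awalk u p v \<Longrightarrow> c \<le> ereal (real (length p))"
  shows "c \<le> graph_dist G u v"
  unfolding graph_dist_def \<mu>_def
  by (rule INF_greatest) (use assms in \<open>auto simp: awalk_cost_def sum_list_triv\<close>)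

lemma awalk_arc: "(u, v) \<in> parcs G \<Longrightarrow> awalk u [(u, v)] v"
  by (auto simp: awalk_def dest: wellformed')

lemma awalk_two_arcs: "(u, w) \<in> parcs G \<Longrightarrow> (w, v) \<in> parcs G \<Longrightarrow> awalk u [(u, w), (w, v)] v"
  by (auto simp: awalk_def dest: wellformed')

lemma graph_dist_eq_2:
  assumes "(u, w) \<in> parcs G" "(w, v) \<in> parcs G" "u \<noteq> v" "(u, v) \<notin> parcs G"
  shows "graph_dist G u v = 2"
proof (rule antisym)
  show "graph_dist G u v \<le> 2"
    using graph_dist_le_length[OF awalk_two_arcs[OF assms(1,2)]] by simp
  show "2 \<le> graph_dist G u v"
  proof (rule graph_dist_geI)
    fix p assume p: "awalk u p v"
    have "p \<noteq> []" using p assms(3) by (auto simp: awalk_def)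
    moreover have "p \<noteq> [e]" for e using p assms(4) by (cases e) (auto simp: awalk_def)
    ultimately have "2 \<le> length p" by (cases p; cases "tl p") auto
    then have "real 2 \<le> real (length p)" by (rule of_nat_mono)
    then show "2 \<le> ereal (real (length p))" by simp
  qed
qed

text \<open>If \<open>x\<close> and \<open>v\<close> were not adjacent, \<open>x y v\<close> would
  be a shortest path with its inner vertex \<open>y\<close> in \<open>X\<close>.\<close>

lemma outer_general_position_imp_adjacent_twins:
  assumes "outer_general_position G X"
  shows "adjacent_twins G X"
  unfolding adjacent_twins_def
proof (intro conjI ballI allI impI)
  show "X \<subseteq> pverts G" using assms by (simp add: outer_general_position_def)
next
  fix x y v
  assume xy: "x \<in> X" "y \<in> X" and a: "(x, y) \<in> parcs G \<and> (y, v) \<in> parcs G \<and> v \<noteq> x"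
  then have v: "v \<in> pverts G" by (auto dest: wellformed')
  have pos: "positionable G X x v"
    \<comment> \<open>The two clauses of the definition together make \<open>x\<close> positionable
      with every vertex of the graph.\<close>
    using assms xy v by (cases "v \<in> X") (auto simp: outer_general_position_def)
  have ne: "x \<noteq> y" "y \<noteq> v" using a no_loops' by auto
  show "(x, v) \<in> parcs G"
  proof (rule ccontr)
    assume "(x, v) \<notin> parcs G"
    then have "graph_dist G x v = 2" using a by (intro graph_dist_eq_2) auto
    moreover have "apath x [(x, y), (y, v)] v"
      using a ne by (auto simp: apath_def awalk_two_arcs)
    ultimately have "shortest_path G x [(x, y), (y, v)] v"
      by (simp add: shortest_path_def)
    then have "(set (pawalk_verts x [(x, y), (y, v)]) - {x, v}) \<inter> X = {}"
      using pos unfolding positionable_def by blast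
    then show False using xy ne by auto
  qed
qed

lemma adjacent_twins_imp_outer_general_position:
  assumes "adjacent_twins G X" and "diam_le_2 G"
  shows "outer_general_position G X"
proof -
  have X: "X \<subseteq> pverts G" using assms(1) by (simp add: adjacent_twins_def)
  have "positionable G X u v" if u: "u \<in> X" and v: "v \<in> pverts G" for u v
    unfolding positionable_def
  proof (intro allI impI)
    fix p assume sp: "shortest_path G u p v"
    then have p: "apath u p v" and len: "ereal (real (length p)) = graph_dist G u v"
      by (auto simp: shortest_path_def)
    have "graph_dist G u v \<le> 2" using assms(2) u v X by (auto simp: diam_le_2_def)
    then have "ereal (real (length p)) \<le> ereal 2" using len by simp
    then have "length p \<le> 2" by simp
    then consider "p = []" | e where "p = [e]" | e f where "p = [e, f]"
      by (cases p; cases "tl p") auto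
    then show "(set (pawalk_verts u p) - {u, v}) \<inter> X = {}"
    proof cases
      case 1
      then show ?thesis by simp
    next
      case 2
      then show ?thesis using p by (auto simp: apath_def awalk_def)
    next
      case 3
      then obtain w where w: "p = [(u, w), (w, v)]" "(u, w) \<in> parcs G" "(w, v) \<in> parcs G" "v \<noteq> u"
        using p by (cases e; cases f) (auto simp: apath_def awalk_def)
      \<comment> \<open>An arc would be a walk of length 1, while the shortest path \<open>p\<close>
        has length 2.\<close>
      have "(u, v) \<notin> parcs G"
      proof
        assume "(u, v) \<in> parcs G"
        from graph_dist_le_length[OF awalk_arc[OF this]]
        have "ereal (real (length p)) \<le> ereal 1" using len by simp
        then show False using w(1) by simp
      qed
      \<comment> \<open>Otherwise \<open>u\<close> and \<open>w\<close> would be adjacent members of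
        \<open>X\<close>, and the arc from \<open>w\<close> to \<open>v\<close> would force one from
        \<open>u\<close> to \<open>v\<close>.\<close>
      then have "w \<notin> X" using assms(1) u w unfolding adjacent_twins_def by blast
      then show ?thesis using w(1) by auto
    qed
  qed
  then show ?thesis using X by (auto simp: outer_general_position_def)
qed

lemma outer_general_position_iff_adjacent_twins:
  "diam_le_2 G \<Longrightarrow> outer_general_position G X \<longleftrightarrow> adjacent_twins G X"
  using outer_general_position_imp_adjacent_twins adjacent_twins_imp_outer_general_position by blast

text \<open>Lets the product and the join be handled by exhibiting one common neighbour, without
  computing distances.\<close>

lemma diam_le_2I:
  assumes "\<And>u v. u \<in> pverts G \<Longrightarrow> v \<in> pverts G \<Longrightarrow> u \<noteq> v \<Longrightarrow> (u, v) \<notin> parcs G \<Longrightarrow>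
    \<exists>w. (u, w) \<in> parcs G \<and> (w, v) \<in> parcs G"
  shows "diam_le_2 G"
  unfolding diam_le_2_def
proof (intro ballI)
  fix u v assume uv: "u \<in> pverts G" "v \<in> pverts G"
  have "\<exists>p. awalk u p v \<and> length p \<le> 2"
  proof (cases "u = v")
    case True
    then show ?thesis using uv by (intro exI[of _ "[]"]) (auto simp: awalk_def)
  next
    case ne: False
    show ?thesis
    proof (cases "(u, v) \<in> parcs G")
      case True
      then show ?thesis by (intro exI[of _ "[(u, v)]"]) (auto simp: awalk_arc)
    next
      case False
      then obtain w where "(u, w) \<in> parcs G" "(w, v) \<in> parcs G" using assms uv ne by blast
      then show ?thesis by (intro exI[of _ "[(u, w), (w, v)]"]) (auto simp: awalk_two_arcs)
    qed
  qed
  then obtain p where p: "awalk u p v" "real (length p) \<le> real 2" by (auto simp only: of_nat_le_iff)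
  have "graph_dist G u v \<le> ereal (real (length p))" by (rule graph_dist_le_length) fact
  also have "\<dots> \<le> 2" using p(2) by simp
  finally show "graph_dist G u v \<le> 2" .
qed

text \<open>The non-neighbour obtained here later separates vertices of different layers of the
  product, and the apex of the join from a vertex of \<open>H\<close>.\<close>

lemma not_universal_vertexE:
  assumes "\<nexists>u. universal_vertex G u" "h \<in> pverts G"
  obtains h' where "h' \<in> pverts G" "h' \<noteq> h" "(h, h') \<notin> parcs G"
  using assms by (auto simp: universal_vertex_def)

end

section \<open>The lexicographic product with a complete graph\<close>

lemma diam_le_2_lex_product:
  assumes "m \<ge> 2" "complete_digraph m (with_proj Km)" "pair_graph H"
  shows "diam_le_2 (lex_product Km H)"
proof -
  from assms(2) have K: "finite (pverts Km)" "card (pverts Km) = m"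
      "parcs Km = {(u, v). (u, v) \<in> pverts Km \<times> pverts Km \<and> u \<noteq> v}"
    by (auto simp: complete_digraph_pair_def)
  have other: "\<exists>g'\<in>pverts Km. g' \<noteq> g" for g
  proof (rule ccontr)
    assume "\<not> ?thesis"
    then have "pverts Km \<subseteq> {g}" by blast
    then have "card (pverts Km) \<le> 1" using card_mono[of "{g}"] by fastforce
    then show False using K assms(1) by simp
  qed
  interpret L: pair_graph "lex_product Km H"
    by (intro pair_graph_lex_product pair_graphI_complete[OF assms(2)] assms(3))
  show ?thesis
  proof (rule L.diam_le_2I)
    fix u v
    assume uv: "u \<in> pverts (lex_product Km H)" "v \<in> pverts (lex_product Km H)"
      and na: "(u, v) \<notin> parcs (lex_product Km H)"
    obtain g h g2 h2 where e: "u = (g, h)" "v = (g2, h2)" by (cases u; cases v)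
    \<comment> \<open>Vertices of different layers are adjacent, so \<open>u\<close> and
      \<open>v\<close> share a layer, and every vertex of another layer is a common neighbour;
      \<open>m \<ge> 2\<close> provides such a layer.\<close>
    then have "g2 = g" using uv na K by (auto simp: lex_product_def)
    moreover obtain g' where "g' \<in> pverts Km" "g' \<noteq> g" using other by blast
    ultimately show "\<exists>w. (u, w) \<in> parcs (lex_product Km H) \<and> (w, v) \<in> parcs (lex_product Km H)"
      \<comment> \<open>The second coordinate is arbitrary; \<open>h\<close> is simply a vertex of
        \<open>H\<close> at hand.\<close>
      using uv e K by (intro exI[of _ "(g', h)"]) (auto simp: lex_product_def)
  qed
qed

text \<open>A vertex outside the layer is adjacent to all of the layer or to none of it, so it never
  distinguishes two vertices of the layer; only \<open>H\<close> matters.\<close>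

lemma adjacent_twins_lex_product_layer:
  assumes "g \<in> pverts G" "pair_graph G" "pair_graph H"
  shows "adjacent_twins (lex_product G H) ({g} \<times> Y) \<longleftrightarrow> adjacent_twins H Y"
proof -
  interpret G: pair_graph G by fact
  interpret H: pair_graph H by fact
  have loop: "(g, g) \<notin> parcs G" using G.no_loops' by blast
  show ?thesis
  proof
    assume A: "adjacent_twins (lex_product G H) ({g} \<times> Y)"
    then have Y: "Y \<subseteq> pverts H" by (auto simp: adjacent_twins_def lex_product_def)
    show "adjacent_twins H Y"
      unfolding adjacent_twins_def
    proof (intro conjI ballI allI impI)
      fix x y v assume xy: "x \<in> Y" "y \<in> Y"
        and a: "(x, y) \<in> parcs H \<and> (y, v) \<in> parcs H \<and> v \<noteq> x"
      have "((g, x), (g, v)) \<in> parcs (lex_product G H)"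
        using A[unfolded adjacent_twins_def, THEN conjunct2, rule_format, of "(g, x)" "(g, y)" "(g, v)"]
          xy a assms(1) by (auto simp: lex_product_def dest: H.wellformed')
      \<comment> \<open>Since \<open>G\<close> has no loop at \<open>g\<close>, an arc inside the
        layer must come from \<open>H\<close>.\<close>
      then show "(x, v) \<in> parcs H" using loop by (auto simp: lex_product_def)
    qed (fact Y)
  next
    assume A: "adjacent_twins H Y"
    show "adjacent_twins (lex_product G H) ({g} \<times> Y)"
      unfolding adjacent_twins_def
    proof (intro conjI ballI allI impI)
      show "{g} \<times> Y \<subseteq> pverts (lex_product G H)"
        using A assms(1) by (auto simp: adjacent_twins_def lex_product_def)
    next
      fix x y v assume "x \<in> {g} \<times> Y" "y \<in> {g} \<times> Y"
        and a: "(x, y) \<in> parcs (lex_product G H) \<and> (y, v) \<in> parcs (lex_product G H) \<and> v \<noteq> x"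
      then obtain x' y' v' k where e: "x = (g, x')" "y = (g, y')" "v = (k, v')" "x' \<in> Y" "y' \<in> Y"
        by (cases v) blast
      have *: "k \<in> pverts G" "v' \<in> pverts H" "x' \<in> pverts H" "(x', y') \<in> parcs H"
          "(g, k) \<in> parcs G \<or> k = g \<and> (y', v') \<in> parcs H"
        using a e loop by (auto simp: lex_product_def)
      have "(g, k) \<in> parcs G \<or> k = g \<and> (x', v') \<in> parcs H"
      proof (cases "k = g")
        case True
        then have "(y', v') \<in> parcs H" "v' \<noteq> x'" using * loop a e by auto
        then show ?thesis using A e * True unfolding adjacent_twins_def by blast
      qed (use * in blast)
      then show "(x, v) \<in> parcs (lex_product G H)"
        using * assms(1) by (auto simp: e lex_product_def)
    qed
  qed
qed

text \<open>Suppose \<open>(g, h)\<close> and \<open>(g', h')\<close> lie in \<open>X\<close> with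
  \<open>g \<noteq> g'\<close>. For a non-neighbour \<open>k\<close> of \<open>h\<close>, the vertex
  \<open>(g, k)\<close> is adjacent to \<open>(g', h')\<close> but not to \<open>(g, h)\<close>, so
  these adjacent members are not twins.\<close>

lemma adjacent_twins_lex_product_in_layer:
  assumes "complete_digraph m (with_proj Km)" "pair_graph H" "\<nexists>u. universal_vertex H u"
    and "adjacent_twins (lex_product Km H) X" "X \<noteq> {}"
  obtains g Y where "g \<in> pverts Km" "X = {g} \<times> Y"
proof -
  interpret H: pair_graph H by fact
  have K: "parcs Km = {(u, v). (u, v) \<in> pverts Km \<times> pverts Km \<and> u \<noteq> v}"
    using assms(1) by (auto simp: complete_digraph_pair_def)
  have X: "X \<subseteq> pverts Km \<times> pverts H"
    using assms(4) by (simp add: adjacent_twins_def lex_product_def)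
  obtain g h where gh: "(g, h) \<in> X" using assms(5) by auto
  have "g' = g" if g'h': "(g', h') \<in> X" for g' h'
  proof (rule ccontr)
    assume ne: "g' \<noteq> g"
    obtain k where k: "k \<in> pverts H" "k \<noteq> h" "(h, k) \<notin> parcs H"
      using H.not_universal_vertexE[OF assms(3), of h] gh X by blast
    have "((g, h), (g, k)) \<in> parcs (lex_product Km H)"
      using assms(4)[unfolded adjacent_twins_def, THEN conjunct2, rule_format,
          of "(g, h)" "(g', h')" "(g, k)"] gh g'h' ne k X K
      by (auto simp: lex_product_def)
    then show False using k K by (auto simp: lex_product_def)
  qed
  then have "X = {g} \<times> snd ` X" by force
  then show ?thesis using that gh X by blast
qed

text \<open>Each nonempty set of twins in \<open>H\<close> has \<open>m\<close> copies, one per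
  layer. Hence the sets of attained cardinalities are compared, not the families themselves.\<close>

lemma card_adjacent_twins_lex_product:
  assumes "m \<ge> 2" "complete_digraph m (with_proj Km)" "pair_graph H" "\<nexists>u. universal_vertex H u"
  shows "card ` {X. adjacent_twins (lex_product Km H) X} = card ` {Y. adjacent_twins H Y}"
proof (intro set_eqI iffI)
  note layer = adjacent_twins_lex_product_layer[OF _ pair_graphI_complete[OF assms(2)] assms(3)]
  fix n
  {
    assume "n \<in> card ` {X. adjacent_twins (lex_product Km H) X}"
    then obtain X where X: "adjacent_twins (lex_product Km H) X" "n = card X" by blast
    show "n \<in> card ` {Y. adjacent_twins H Y}"
    \<comment> \<open>The empty set determines no layer and is matched with the empty set of
      \<open>H\<close>.\<close>
    proof (cases "X = {}")
      case True
      then have "n = card {}" using X by simp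
      moreover have "adjacent_twins H {}" by (simp add: adjacent_twins_def)
      ultimately show ?thesis by blast
    next
      case False
      obtain g Y where gY: "g \<in> pverts Km" "X = {g} \<times> Y"
        using adjacent_twins_lex_product_in_layer[OF assms(2-4) X(1) False] by blast
      have "adjacent_twins H Y" "n = card Y"
        using layer[OF gY(1)] X gY(2) by (simp_all add: card_cartesian_product)
      then show ?thesis by blast
    qed
  next
    assume "n \<in> card ` {Y. adjacent_twins H Y}"
    then obtain Y where Y: "adjacent_twins H Y" "n = card Y" by blast
    have "card (pverts Km) = m" using assms(2) by (simp add: complete_digraph_pair_def)
    then obtain g where g: "g \<in> pverts Km" using assms(1) by fastforce
    have "adjacent_twins (lex_product Km H) ({g} \<times> Y)" "n = card ({g} \<times> Y)"
      using layer[OF g] Y by (simp_all add: card_cartesian_product)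
    then show "n \<in> card ` {X. adjacent_twins (lex_product Km H) X}" by blast
  }
qed

section \<open>The join with a single vertex\<close>

lemma complete_digraph_1E:
  assumes "complete_digraph 1 (with_proj K1)"
  obtains a where "pverts K1 = {a}" "parcs K1 = {}"
proof -
  obtain a where a: "pverts K1 = {a}"
    using assms by (auto simp: complete_digraph_pair_def card_1_singleton_iff)
  then have "parcs K1 = {}" using assms by (auto simp: complete_digraph_pair_def)
  then show ?thesis using a that by blast
qed

lemma diam_le_2_graph_join:
  assumes "complete_digraph 1 (with_proj K1)" "pair_graph H"
  shows "diam_le_2 (graph_join K1 H)"
proof -
  obtain a where a: "pverts K1 = {a}" "parcs K1 = {}" by (rule complete_digraph_1E[OF assms(1)])
  interpret J: pair_graph "graph_join K1 H"
    by (intro pair_graph_graph_join pair_graphI_complete[OF assms(1)] assms(2))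
  show ?thesis
  proof (rule J.diam_le_2I)
    fix u v
    assume "u \<in> pverts (graph_join K1 H)" "v \<in> pverts (graph_join K1 H)" "u \<noteq> v"
      "(u, v) \<notin> parcs (graph_join K1 H)"
    then show "\<exists>w. (u, w) \<in> parcs (graph_join K1 H) \<and> (w, v) \<in> parcs (graph_join K1 H)"
      \<comment> \<open>Distinct non-adjacent vertices both lie in the copy of \<open>H\<close>, and
        the apex \<open>Inl a\<close> is adjacent to both.\<close>
      by (intro exI[of _ "Inl a"]) (auto simp: graph_join_def a)
  qed
qed

text \<open>The apex is adjacent to every vertex of the copy of \<open>H\<close>, so it
  distinguishes no two of them.\<close>

lemma adjacent_twins_graph_join_image:
  assumes "complete_digraph 1 (with_proj K1)"
  shows "adjacent_twins (graph_join K1 H) (Inr ` Y) \<longleftrightarrow> adjacent_twins H Y"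
proof -
  obtain a where a: "pverts K1 = {a}" "parcs K1 = {}" by (rule complete_digraph_1E[OF assms])
  show ?thesis
  proof
    assume A: "adjacent_twins (graph_join K1 H) (Inr ` Y)"
    then have Y: "Y \<subseteq> pverts H" by (auto simp: adjacent_twins_def graph_join_def)
    show "adjacent_twins H Y"
      unfolding adjacent_twins_def
    proof (intro conjI ballI allI impI)
      fix x y v assume xy: "x \<in> Y" "y \<in> Y" and h: "(x, y) \<in> parcs H \<and> (y, v) \<in> parcs H \<and> v \<noteq> x"
      have "(Inr x, Inr v) \<in> parcs (graph_join K1 H)"
        using A[unfolded adjacent_twins_def, THEN conjunct2, rule_format,
            of "Inr x" "Inr y" "Inr v"] xy h by (simp add: graph_join_def)
      then show "(x, v) \<in> parcs H" by (simp add: graph_join_def)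
    qed (fact Y)
  next
    assume A: "adjacent_twins H Y"
    show "adjacent_twins (graph_join K1 H) (Inr ` Y)"
      unfolding adjacent_twins_def
    proof (intro conjI ballI allI impI)
      show "Inr ` Y \<subseteq> pverts (graph_join K1 H)"
        using A by (auto simp: adjacent_twins_def graph_join_def)
    next
      fix x y v assume "x \<in> Inr ` Y" "y \<in> Inr ` Y"
        and h: "(x, y) \<in> parcs (graph_join K1 H) \<and> (y, v) \<in> parcs (graph_join K1 H) \<and> v \<noteq> x"
      then obtain x' y' where e: "x = Inr x'" "y = Inr y'" "x' \<in> Y" "y' \<in> Y" by blast
      show "(x, v) \<in> parcs (graph_join K1 H)"
      proof (cases v)
        case (Inl b)
        then have "b \<in> pverts K1" using h e a by (simp add: graph_join_def)
        moreover have "x' \<in> pverts H" using A e by (auto simp: adjacent_twins_def)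
        ultimately show ?thesis using Inl e by (simp add: graph_join_def)
      next
        case (Inr v')
        then have "(x', y') \<in> parcs H" "(y', v') \<in> parcs H" "v' \<noteq> x'"
          using h e by (simp_all add: graph_join_def)
        then have "(x', v') \<in> parcs H" using A e unfolding adjacent_twins_def by blast
        then show ?thesis using Inr e by (simp add: graph_join_def)
      qed
    qed
  qed
qed

text \<open>The apex and \<open>Inr h\<close> cannot both lie in \<open>X\<close>: for a
  non-neighbour \<open>k\<close> of \<open>h\<close>, the vertex \<open>Inr k\<close> is adjacent to
  the apex but not to \<open>Inr h\<close>.\<close>

lemma adjacent_twins_graph_join_cases:
  assumes "complete_digraph 1 (with_proj K1)" "pair_graph H" "\<nexists>u. universal_vertex H u"
    and "adjacent_twins (graph_join K1 H) X"
  obtains a where "X = {Inl a}" | Y where "X = Inr ` Y"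
proof -
  interpret H: pair_graph H by fact
  obtain a where a: "pverts K1 = {a}" "parcs K1 = {}" by (rule complete_digraph_1E[OF assms(1)])
  have X: "X \<subseteq> insert (Inl a) (Inr ` pverts H)"
    using assms(4) by (auto simp: adjacent_twins_def graph_join_def a)
  show ?thesis
  proof (cases "Inl a \<in> X")
    case True
    have "Inr h \<notin> X" for h
    proof
      assume h: "Inr h \<in> X"
      obtain k where k: "k \<in> pverts H" "k \<noteq> h" "(h, k) \<notin> parcs H"
        using H.not_universal_vertexE[OF assms(3), of h] h X by blast
      have "(Inr h, Inr k) \<in> parcs (graph_join K1 H)"
        using assms(4)[unfolded adjacent_twins_def, THEN conjunct2, rule_format,
            of "Inr h" "Inl a" "Inr k"] h True k X
        by (auto simp: graph_join_def a)
      then show False using k by (auto simp: graph_join_def)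
    qed
    then have "X = {Inl a}" using X True by auto
    then show ?thesis by (rule that(1))
  next
    case False
    then have "X \<subseteq> Inr ` pverts H" using X by blast
    then show ?thesis using that(2) by (meson subset_imageE)
  qed
qed

lemma adjacent_twins_singleton:
  assumes "pair_graph G" "x \<in> pverts G"
  shows "adjacent_twins G {x}"
proof -
  interpret pair_graph G by fact
  show ?thesis using assms(2) no_loops' by (auto simp: adjacent_twins_def)
qed

lemma card_adjacent_twins_graph_join:
  assumes "complete_digraph 1 (with_proj K1)" "pair_graph H" "\<nexists>u. universal_vertex H u"
    and "pverts H \<noteq> {}"
  shows "card ` {X. adjacent_twins (graph_join K1 H) X} = card ` {Y. adjacent_twins H Y}"
proof (intro set_eqI iffI)
  note join = adjacent_twins_graph_join_image[OF assms(1), of H]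
  fix n
  {
    assume "n \<in> card ` {X. adjacent_twins (graph_join K1 H) X}"
    then obtain X where X: "adjacent_twins (graph_join K1 H) X" "n = card X" by blast
    show "n \<in> card ` {Y. adjacent_twins H Y}"
      using assms(1-3) X(1)
    proof (cases rule: adjacent_twins_graph_join_cases)
      case 1
      \<comment> \<open>The apex alone is not a copy of a set in \<open>H\<close>, but any single
        vertex of \<open>H\<close> realises the same cardinality.\<close>
      obtain h where "h \<in> pverts H" using assms(4) by blast
      then have "adjacent_twins H {h}" using assms(2) by (intro adjacent_twins_singleton)
      moreover have "n = card {h}" using 1 X(2) by simp
      ultimately show ?thesis by blast
    next
      case (2 Y)
      then have "adjacent_twins H Y" "n = card Y" using X join by (simp_all add: card_image)
      then show ?thesis by blast
    qed
  next
    assume "n \<in> card ` {Y. adjacent_twins H Y}"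
    then obtain Y where Y: "adjacent_twins H Y" "n = card Y" by blast
    have "adjacent_twins (graph_join K1 H) (Inr ` Y)" "n = card (Inr ` Y)"
      using join Y by (simp_all add: card_image)
    then show "n \<in> card ` {X. adjacent_twins (graph_join K1 H) X}" by blast
  }
qed

section \<open>Comparison of the maxima\<close>

lemma gp_o_eq_Max_adjacent_twins:
  assumes "pair_graph G" "diam_le_2 G"
  shows "gp_o G = Max (card ` {X. adjacent_twins G X})"
  using pair_graph.outer_general_position_iff_adjacent_twins[OF assms] by (simp add: gp_o_def)

theorem theorem5p7:
  fixes m :: nat
    and Km :: "'a pair_pre_digraph"
    and K1 :: "'b pair_pre_digraph"
    and H :: "'c pair_pre_digraph"
  assumes "m \<ge> 2"
    and "complete_digraph m (with_proj Km)"
    and "complete_digraph 1 (with_proj K1)"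
    and "pair_graph H"
    and "connected (with_proj H)"
    and "card (pverts H) \<ge> 2"
    and "\<nexists>u. universal_vertex H u"
  shows "(graph_diam H = 2 \<longrightarrow> gp_o (lex_product Km H) = gp_o H) \<and>
         (graph_diam H > 2 \<longrightarrow> gp_o (lex_product Km H) = gp_o (graph_join K1 H))"
proof -
  have ne: "pverts H \<noteq> {}" using assms(6) by auto
  have lex: "gp_o (lex_product Km H) = Max (card ` {Y. adjacent_twins H Y})"
    using gp_o_eq_Max_adjacent_twins[OF
        pair_graph_lex_product[OF pair_graphI_complete[OF assms(2)] assms(4)]
        diam_le_2_lex_product[OF assms(1,2,4)]]
    by (simp add: card_adjacent_twins_lex_product[OF assms(1,2,4,7)])
  have join: "gp_o (graph_join K1 H) = Max (card ` {Y. adjacent_twins H Y})"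
    using gp_o_eq_Max_adjacent_twins[OF
        pair_graph_graph_join[OF pair_graphI_complete[OF assms(3)] assms(4)]
        diam_le_2_graph_join[OF assms(3,4)]]
    by (simp add: card_adjacent_twins_graph_join[OF assms(3,4,7) ne])
  \<comment> \<open>The diameter of \<open>H\<close> enters here: it allows outer general position
    inside \<open>H\<close> itself to be expressed by twins.\<close>
  have "gp_o H = Max (card ` {Y. adjacent_twins H Y})" if "graph_diam H = 2"
    using that by (intro gp_o_eq_Max_adjacent_twins assms(4) diam_le_2I_graph_diam) simp
  then show ?thesis using lex join by simp
qed

end
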